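(* Let $(X,d_\eta)$ be an $\eta$-cone metric space over the Banach space $E$ with the cone $P$, which is normal with normal constant $K$. The mapping $D_\eta:X\times X\to[0,\infty)$ defined by $D_\eta(x,y)=\|d_\eta(x,y)\|$ satisfies the following properties: (D1) $D_\eta(x,x)=0$ for any $x\in X$; (D2) $D_\eta(x,y)=D_\eta(y,x)$ for any $x,y\in X$; (D3) $D_\eta(x,y)\le K\,\eta(x,y)\big(D_\eta(x,z)+D_\eta(z,y)\big)$ for any points $x,y,z\in X$.
   Context: Let $E$ be a real Banach space with norm $\|\cdot\|$ and zero vector $\theta$. A subset $P\subset E$ is a cone if: $P$ is closed, nonempty and $P\neq\{\theta\}$; $ax+by\in P$ for all $x,y\in P$ and all real $a,b\ge 0$; and $x\in P$, $-x\in P$ imply $x=\theta$. Write $x\preceq y$ iff $y-x\in P$. The cone $P$ is normal if there is a real $C>0$ such that $\theta\preceq x\preceq y$ implies $\|x\|\le C\|y\|$ for all $x,y\in E$; the least such positive number $K$ is the normal constant. Standing assumption: $P$ is normal and its interior $\mathrm{Int}(P)$ is nonempty. Let $X$ be a nonempty set and $\eta:X\times X\to[1,\infty)$ a map. A function $d_\eta:X\times X\to E$ is an $\eta$-cone metric on $X$, and $(X,d_\eta)$ an $\eta$-cone metric space, if for all $x,y,z\in X$: (d1) $\theta\preceq d_\eta(x,y)$, and $d_\eta(x,y)=\theta$ iff $x=y$; (d2) $d_\eta(x,y)=d_\eta(y,x)$; (d3) $d_\eta(x,z)\preceq\eta(x,z)[d_\eta(x,y)+d_\eta(y,z)]$.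 *)

theory Defs
  imports "HOL-Analysis.Analysis"
begin

text \<open>The library predicates \<open>cone\<close> and \<open>convex_cone\<close> require neither closedness nor
  pointedness, hence a separate predicate. The zero vector is written \<open>0\<close>.\<close>

definition banach_cone :: "'e::banach set \<Rightarrow> bool" where
  "banach_cone P \<longleftrightarrow>
     closed P \<and> P \<noteq> {} \<and> P \<noteq> {0} \<and>
     (\<forall>x\<in>P. \<forall>y\<in>P. \<forall>a b::real. a \<ge> 0 \<longrightarrow> b \<ge> 0 \<longrightarrow> a *\<^sub>R x + b *\<^sub>R y \<in> P) \<and>
     (\<forall>x. x \<in> P \<longrightarrow> - x \<in> P \<longrightarrow> x = 0)"

definition cone_le :: "'e::banach set \<Rightarrow> 'e \<Rightarrow> 'e \<Rightarrow> bool" where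
  "cone_le P x y \<longleftrightarrow> y - x \<in> P"

definition normality_bound :: "'e::banach set \<Rightarrow> real \<Rightarrow> bool" where
  "normality_bound P C \<longleftrightarrow>
     C > 0 \<and> (\<forall>x y. cone_le P 0 x \<longrightarrow> cone_le P x y \<longrightarrow> norm x \<le> C * norm y)"

definition normal_cone :: "'e::banach set \<Rightarrow> bool" where
  "normal_cone P \<longleftrightarrow> banach_cone P \<and> (\<exists>C. normality_bound P C)"

text \<open>\<open>LEAST\<close> on the reals is only meaningful if a minimum exists. For a normal cone it does:
  taking \<open>x = y \<noteq> 0\<close> in \<open>P\<close> shows that every bound is at least 1, and the defining
  inequalities are preserved under infima.\<close>

definition normal_constant :: "'e::banach set \<Rightarrow> real" where
  "normal_constant P = (LEAST C. normality_bound P C)"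

text \<open>Maps on \<open>X \<times> X\<close> are curried total functions whose values outside the carrier \<open>X\<close>
  are irrelevant.\<close>

definition eta_cone_metric_space ::
    "'e::banach set \<Rightarrow> 'a set \<Rightarrow> ('a \<Rightarrow> 'a \<Rightarrow> real) \<Rightarrow> ('a \<Rightarrow> 'a \<Rightarrow> 'e) \<Rightarrow> bool" where
  "eta_cone_metric_space P X \<eta> d \<longleftrightarrow>
     X \<noteq> {} \<and>
     (\<forall>x\<in>X. \<forall>y\<in>X. \<eta> x y \<ge> 1) \<and>
     (\<forall>x\<in>X. \<forall>y\<in>X. cone_le P 0 (d x y) \<and> (d x y = 0 \<longleftrightarrow> x = y)) \<and>
     (\<forall>x\<in>X. \<forall>y\<in>X. d x y = d y x) \<and>
     (\<forall>x\<in>X. \<forall>y\<in>X. \<forall>z\<in>X. cone_le P (d x z) (\<eta> x z *\<^sub>R (d x y + d y z)))"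

definition norm_dist :: "('a \<Rightarrow> 'a \<Rightarrow> 'e::banach) \<Rightarrow> 'a \<Rightarrow> 'a \<Rightarrow> real" where
  "norm_dist d x y = norm (d x y)"

end

theory Submission
  imports Defs
begin

text \<open>
  The triangle-type axiom places \<open>d x y\<close> below \<open>\<eta> x y *\<^sub>R (d x z + d z y)\<close> in the cone
  order, so normality bounds its norm by \<open>K\<close> times the norm of the right-hand side, and the
  triangle inequality for the norm in \<open>E\<close> splits that into the two distances. The only point that
  needs an argument is that the normal constant is itself an admissible constant, i.e.\ that the
  least one exists (\<open>normality_bound_normal_constant\<close>): the admissible constants are bounded below
  by \<open>1\<close>, and their infimum still satisfies every defining inequality.
\<close>

text \<open>Comparing a nonzero element of the cone with itself shows that no admissible constant is
  smaller than one. This keeps the infimum of these constants strictly positive.\<close>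

lemma normality_bound_ge_1:
  fixes P :: "'e::banach set"
  assumes "banach_cone P" and "normality_bound P C"
  shows "C \<ge> 1"
proof -
  obtain x where x: "x \<in> P" "x \<noteq> 0"
    using assms(1) unfolding banach_cone_def by blast
  have "0 *\<^sub>R x + 0 *\<^sub>R x \<in> P"
    using assms(1) x(1) unfolding banach_cone_def by blast
  then have "norm x \<le> C * norm x"
    using assms(2) x(1) unfolding normality_bound_def cone_le_def by simp
  with x(2) show ?thesis by simp
qed

text \<open>For fixed \<open>x\<close> and \<open>y\<close> with \<open>y \<noteq> 0\<close> the admissible constants all dominate
  \<open>norm x / norm y\<close>, hence so does their infimum; for \<open>y = 0\<close> any single one of them
  forces \<open>x = 0\<close>.\<close>

lemma normality_bound_normal_constant:
  fixes P :: "'e::banach set"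
  assumes "normal_cone P"
  shows "normality_bound P (normal_constant P)"
proof -
  define S where "S = {C. normality_bound P C}"
  have ne: "S \<noteq> {}" and ge1: "\<And>C. C \<in> S \<Longrightarrow> 1 \<le> C"
    using assms normality_bound_ge_1 unfolding normal_cone_def S_def by auto
  have bdd: "bdd_below S" using ge1 by (rule bdd_belowI)
  have pos: "Inf S > 0" using cInf_greatest[OF ne ge1] by simp
  have "norm x \<le> Inf S * norm y" if "cone_le P 0 x" "cone_le P x y" for x y
  proof -
    have *: "norm x \<le> C * norm y" if "C \<in> S" for C
      using that \<open>cone_le P 0 x\<close> \<open>cone_le P x y\<close> unfolding S_def normality_bound_def by blast
    show ?thesis
    proof (cases "y = 0")
      case True
      with * ne show ?thesis by auto
    next
      case False
      then have "norm x / norm y \<le> Inf S"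
        by (intro cInf_greatest[OF ne]) (simp add: * divide_le_eq)
      with False show ?thesis by (simp add: divide_le_eq)
    qed
  qed
  with pos have bound: "normality_bound P (Inf S)"
    unfolding normality_bound_def by blast
  have "normal_constant P = Inf S"
    unfolding normal_constant_def
  proof (rule Least_equality)
    show "normality_bound P (Inf S)" by (fact bound)
    show "Inf S \<le> C" if "normality_bound P C" for C
      using that bdd by (intro cInf_lower) (simp_all add: S_def)
  qed
  with bound show ?thesis by simp
qed

theorem theorem4p6:
  fixes P :: "'e::banach set"
    and X :: "'a set"
    and \<eta> :: "'a \<Rightarrow> 'a \<Rightarrow> real"
    and d :: "'a \<Rightarrow> 'a \<Rightarrow> 'e"
    and K :: real
  assumes "normal_cone P"
    and "interior P \<noteq> {}"
    and "K = normal_constant P"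
    and "eta_cone_metric_space P X \<eta> d"
  shows "(\<forall>x\<in>X. \<forall>y\<in>X. norm_dist d x y \<in> {0..}) \<and>
    (\<forall>x\<in>X. norm_dist d x x = 0) \<and>
    (\<forall>x\<in>X. \<forall>y\<in>X. norm_dist d x y = norm_dist d y x) \<and>
    (\<forall>x\<in>X. \<forall>y\<in>X. \<forall>z\<in>X.
       norm_dist d x y \<le> K * \<eta> x y * (norm_dist d x z + norm_dist d z y))"
proof -
  have \<eta>: "\<And>x y. x \<in> X \<Longrightarrow> y \<in> X \<Longrightarrow> \<eta> x y \<ge> 1"
    and nonneg: "\<And>x y. x \<in> X \<Longrightarrow> y \<in> X \<Longrightarrow> cone_le P 0 (d x y)"
    and refl: "\<And>x. x \<in> X \<Longrightarrow> d x x = 0"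
    and sym: "\<And>x y. x \<in> X \<Longrightarrow> y \<in> X \<Longrightarrow> d x y = d y x"
    using assms(4) by (simp_all add: eta_cone_metric_space_def)
  have tri: "\<And>x y z. x \<in> X \<Longrightarrow> y \<in> X \<Longrightarrow> z \<in> X \<Longrightarrow>
      cone_le P (d x y) (\<eta> x y *\<^sub>R (d x z + d z y))"
    using assms(4) unfolding eta_cone_metric_space_def by blast
  have K: "normality_bound P K"
    using normality_bound_normal_constant[OF assms(1)] assms(3) by simp
  have "norm (d x y) \<le> K * \<eta> x y * (norm (d x z) + norm (d z y))"
    if "x \<in> X" "y \<in> X" "z \<in> X" for x y z
  proof -
    have "norm (d x y) \<le> K * norm (\<eta> x y *\<^sub>R (d x z + d z y))"
      using K nonneg tri that unfolding normality_bound_def by blast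
    also have "\<dots> = K * \<eta> x y * norm (d x z + d z y)"
      using \<eta>[of x y] that by simp
    also have "\<dots> \<le> K * \<eta> x y * (norm (d x z) + norm (d z y))"
      using K \<eta>[of x y] that unfolding normality_bound_def
      by (intro mult_left_mono norm_triangle_ineq) auto
    finally show ?thesis .
  qed
  moreover have "norm (d x y) = norm (d y x)" if "x \<in> X" "y \<in> X" for x y
    using sym[OF that] by simp
  ultimately show ?thesis
    unfolding norm_dist_def using refl by simp
qed

end
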